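(* Analytically for $|t|<1$, or formally in the $t$-adic completion, $$F_{t,s}(u)=\frac{(u;t)_\infty\,(-su;t)_\infty}{(-u;t)_\infty\,(su;t)_\infty}.$$ That is, the identity holds for complex $t,s$ with $|t|<1$ as an identity of power series in $u$ (convergent for $|u|$ sufficiently small), and it also holds for indeterminates $t,s$ as an identity in $\mathbb{Q}[s][[t]][[u]]$.
   Context: $$F_{t,s}(u)=\exp\Big(-2\sum_{n\ge1,\ n\text{ odd}}\frac{1-s^n}{1-t^n}\frac{u^n}{n}\Big),$$ where in the formal version $\frac{1}{1-t^n}$ is expanded as $\sum_{j\ge0}t^{jn}$. The infinite Pochhammer symbol is $(a;t)_\infty=\prod_{j\ge0}(1-at^j)$. *)

theory Defs
  imports "HOL-Analysis.Analysis"
begin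

unbundle fps_syntax

section \<open>Analytic version\<close>

definition qpoch :: "complex \<Rightarrow> complex \<Rightarrow> complex" where
  "qpoch a t = (\<Prod>j. 1 - a * t ^ j)"

definition F_term :: "complex \<Rightarrow> complex \<Rightarrow> complex \<Rightarrow> nat \<Rightarrow> complex" where
  "F_term t s u n = (if odd n then (1 - s ^ n) / (1 - t ^ n) * (u ^ n / of_nat n) else 0)"

definition F :: "complex \<Rightarrow> complex \<Rightarrow> complex \<Rightarrow> complex" where
  "F t s u = exp (- 2 * (\<Sum>n. F_term t s u n))"

text \<open>\<open>F\<close> as a formal power series in \<open>u\<close>, for numerical \<open>t\<close> and \<open>s\<close>.\<close>

definition F_fps :: "complex \<Rightarrow> complex \<Rightarrow> complex fps" where
  "F_fps t s = fps_exp 1 oo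
     Abs_fps (\<lambda>n. if odd n then - 2 * ((1 - s ^ n) / (1 - t ^ n)) / of_nat n else 0)"

section \<open>Formal version\<close>

text \<open>
  The ring \<open>\<rat>[s][[t]][[u]]\<close> is the type \<open>rat poly fps fps\<close>: the polynomial variable is
  \<open>s\<close>, the inner series variable is \<open>t\<close> and the outer one is \<open>u\<close>.
\<close>

type_synonym fring = "rat poly fps fps"

definition svar :: fring where "svar = fps_const (fps_const [:0, 1:])"
definition tvar :: fring where "tvar = fps_const fps_X"
definition uvar :: fring where "uvar = fps_X"

definition tadic_limit :: "(nat \<Rightarrow> fring) \<Rightarrow> fring \<Rightarrow> bool" where
  "tadic_limit X L \<longleftrightarrow> (\<forall>k. \<forall>\<^sub>F N in sequentially. tvar ^ k dvd X N - L)"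

definition formal_qpoch_partial :: "fring \<Rightarrow> nat \<Rightarrow> fring" where
  "formal_qpoch_partial a N = (\<Prod>j<N. 1 - a * tvar ^ j)"

definition formal_qpoch :: "fring \<Rightarrow> fring" where
  "formal_qpoch a = (THE P. tadic_limit (formal_qpoch_partial a) P)"

text \<open>
  The expansion of \<open>1 / (1 - t ^ n)\<close> in \<open>\<rat>[s][[t]]\<close>. The metric on the type \<open>_ fps\<close>
  is the one of the \<open>t\<close>-adic topology, with discrete coefficients.
\<close>

definition geom :: "nat \<Rightarrow> rat poly fps" where
  "geom n = (\<Sum>j. fps_X ^ (j * n))"

definition formal_exponent :: fring where
  "formal_exponent = Abs_fps (\<lambda>n. if odd n
     then fps_const [:- 2 / of_nat n:] * (fps_const (1 - [:0, 1:] ^ n) * geom n) else 0)"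

text \<open>
  \<open>rat poly fps\<close> is not a field, so \<open>fps_exp\<close> is not available here; this is its defining
  series, with coefficients in \<open>\<rat>\<close> embedded in \<open>\<rat>[s][[t]]\<close>.
\<close>

definition formal_exp :: fring where
  "formal_exp = Abs_fps (\<lambda>k. fps_const [:1 / fact k:])"

definition formal_F :: fring where
  "formal_F = formal_exp oo formal_exponent"

end

theory Submission
  imports Defs "HOL-Complex_Analysis.Laurent_Convergence"
begin

text \<open>
  Both halves rest on a functional equation in place of an interchange of the double sum over
  \<open>n\<close> and \<open>j\<close>. Put
  \<open>L(a) = \<Sum> a^n / (n (1 - t^n))\<close> over odd \<open>n\<close>. Replacing \<open>a\<close> by \<open>a t\<close> multiplies the
  \<open>n\<close>-th term by \<open>t^n\<close>, so in \<open>L(a) - L(a t)\<close> the denominators \<open>1 - t^n\<close> cancel and the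
  logarithmic series \<open>\<Sum> a^n / n\<close> over odd \<open>n\<close> is left. Hence
  \<open>G(a) = exp(- 2 L(a))\<close> satisfies \<open>(1 + a) G(a) = (1 - a) G(a t)\<close>, which is also the equation
  of \<open>(a; t)\<^sub>\<infinity> / (- a; t)\<^sub>\<infinity>\<close>. Since the series defining \<open>F\<close> is \<open>L(u) - L(s u)\<close>, the
  identity follows from \<open>G(a) = (a; t)\<^sub>\<infinity> / (- a; t)\<^sub>\<infinity>\<close> for \<open>a = u\<close> and \<open>a = s u\<close>.

  Over the complex numbers the functional equation is iterated \<open>N\<close> times, and
  \<open>G(a t^N) \<rightarrow> G(0) = 1\<close> because \<open>L\<close> is continuous at 0 (\<open>exp_odd_lambert_qpoch\<close>).

  In the formal setting \<open>a = c u\<close> with \<open>c \<in> \<rat>[s][[t]]\<close>, and \<open>a \<mapsto> a t\<close> is the substitution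
  \<open>u \<mapsto> t u\<close>. An equation \<open>Y(u) = D(u) Y(t u)\<close> with \<open>D(0) = 1\<close> determines \<open>Y\<close> from its
  constant term, because it fixes \<open>(1 - t^n) Y\<^sub>n\<close> in terms of the lower coefficients
  (\<open>q_difference_unique\<close>). The laws of the formal exponential that enter the functional equation,
  namely its addition theorem and its value at the odd logarithmic series, follow from the
  uniqueness of solutions of first-order linear differential equations
  (\<open>linear_ode_unique\<close>), which needs no division in the coefficient ring.
\<close>

(* The dollar sign denotes coefficients of power series throughout. *)
unbundle no vec_syntax

section \<open>Convergence of the complex Pochhammer products\<close>

lemma qpoch_convergent:
  fixes a t :: complex
  assumes "norm t < 1"
  shows "convergent_prod (\<lambda>j. 1 - a * t ^ j)"
proof -
  have "summable (\<lambda>j. norm a * norm t ^ j)"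
    using assms by (intro summable_mult summable_geometric) auto
  then have "abs_convergent_prod (\<lambda>j. 1 - a * t ^ j)"
    by (intro summable_imp_abs_convergent_prod) (simp add: norm_mult norm_power)
  then show ?thesis
    by (rule abs_convergent_prod_imp_convergent_prod)
qed

lemma norm_mult_power_less_1:
  fixes a t :: complex
  assumes "norm t < 1" "norm a < 1"
  shows "norm (a * t ^ j) < 1"
proof -
  have "norm a * norm t ^ j \<le> norm a * 1"
    using assms by (intro mult_left_mono power_le_one) auto
  then show ?thesis
    using assms by (simp add: norm_mult norm_power)
qed

lemma qpoch_nonzero:
  fixes a t :: complex
  assumes "norm t < 1" "norm a < 1"
  shows "qpoch a t \<noteq> 0"
proof -
  have "1 - a * t ^ j \<noteq> 0" for j
    using norm_mult_power_less_1[OF assms, of j] by auto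
  then show ?thesis
    unfolding qpoch_def by (intro prodinf_nonzero qpoch_convergent assms)
qed

section \<open>The analytic identity\<close>

text \<open>The branches of the logarithm are irrelevant, since only exponentials of this are used.\<close>

lemma odd_log_series:
  fixes z :: complex
  assumes "norm z < 1"
  shows "(\<lambda>n. if odd n then z ^ n / of_nat n else 0) sums ((ln (1 + z) - ln (1 - z)) / 2)"
proof -
  have "(\<lambda>n. (- ((- z) ^ n) / of_nat n - - ((- (- z)) ^ n) / of_nat n) / 2)
          sums ((ln (1 + z) - ln (1 + - z)) / 2)"
    using assms by (intro sums_divide sums_diff Ln_series') auto
  moreover have "(- ((- z) ^ n) / of_nat n - - ((- (- z)) ^ n) / of_nat n) / 2 =
      (if odd n then z ^ n / of_nat n else 0)" for n
    by simp
  ultimately show ?thesis by simp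
qed

text \<open>
  The series \<open>L\<close> as a power series in \<open>a\<close>, for numerical \<open>t\<close>; the even coefficients vanish.
\<close>

definition odd_lambert :: "complex \<Rightarrow> complex fps" where
  "odd_lambert t = Abs_fps (\<lambda>n. if odd n then 1 / ((1 - t ^ n) * of_nat n) else 0)"

lemma power_neq_1:
  fixes t :: complex
  assumes "norm t < 1" "n > 0"
  shows "t ^ n \<noteq> 1"
  using assms by (metis norm_one norm_power power_less_one_iff less_irrefl norm_ge_zero)

lemma odd_lambert_conv_radius:
  assumes t: "norm t < 1"
  shows "fps_conv_radius (odd_lambert t) \<ge> 1"
  unfolding fps_conv_radius_def
proof (rule conv_radius_geI_ex')
  fix r :: real
  assume r: "0 < r" "ereal r < 1"
  have "summable (\<lambda>n. 1 / (1 - norm t) * r ^ n)"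
    using r by (intro summable_mult summable_geometric) auto
  then show "summable (\<lambda>n. odd_lambert t $ n * complex_of_real r ^ n)"
  proof (rule summable_comparison_test'[where N = 0])
    fix n :: nat
    show "norm (odd_lambert t $ n * complex_of_real r ^ n) \<le> 1 / (1 - norm t) * r ^ n"
    proof (cases "odd n")
      case True
      then have n: "n \<ge> 1" by (cases n) auto
      have "norm t ^ n \<le> norm t ^ 1"
        using t n by (intro power_decreasing) auto
      then have "1 - norm t \<le> norm (1 - t ^ n)"
        using norm_triangle_ineq2[of 1 "t ^ n"] by (simp add: norm_power)
      also have "\<dots> \<le> norm (1 - t ^ n) * real n"
        using n mult_left_mono[of 1 "real n" "norm (1 - t ^ n)"] by simp
      finally have le: "1 - norm t \<le> norm (1 - t ^ n) * real n" .
      have "1 / (norm (1 - t ^ n) * real n) \<le> 1 / (1 - norm t)"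
        using t n le by (intro divide_left_mono mult_pos_pos) auto
      then have "1 / (norm (1 - t ^ n) * real n) * r ^ n \<le> 1 / (1 - norm t) * r ^ n"
        using r by (intro mult_right_mono) auto
      then show ?thesis
        using True r by (simp add: odd_lambert_def norm_mult norm_divide norm_power)
    qed (use t r in \<open>auto simp: odd_lambert_def\<close>)
  qed
qed

lemma odd_lambert_sums:
  assumes "norm t < 1" "norm a < 1"
  shows "(\<lambda>n. odd_lambert t $ n * a ^ n) sums eval_fps (odd_lambert t) a"
proof -
  have "ereal (norm a) < fps_conv_radius (odd_lambert t)"
    using assms by (intro less_le_trans[OF _ odd_lambert_conv_radius]) auto
  then show ?thesis
    unfolding eval_fps_def by (intro summable_sums summable_fps)
qed

text \<open>The functional equation of \<open>exp(- 2 L(a))\<close>.\<close>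

lemma exp_odd_lambert_shift:
  assumes t: "norm t < 1" and a: "norm a < 1"
  shows "exp (- 2 * eval_fps (odd_lambert t) a) * (1 + a) =
         (1 - a) * exp (- 2 * eval_fps (odd_lambert t) (a * t))"
proof -
  define L where "L = eval_fps (odd_lambert t)"
  have at: "norm (a * t) < 1"
    using norm_mult_power_less_1[OF t a, of 1] by simp
  have "(\<lambda>n. odd_lambert t $ n * a ^ n - odd_lambert t $ n * (a * t) ^ n)
          sums (L a - L (a * t))"
    unfolding L_def by (intro sums_diff odd_lambert_sums t a at)
  moreover have "odd_lambert t $ n * a ^ n - odd_lambert t $ n * (a * t) ^ n =
      (if odd n then a ^ n / of_nat n else 0)" for n
  proof (cases "odd n")
    case True
    then have "n > 0" by (cases n) auto
    then have "1 - t ^ n \<noteq> 0" "(of_nat n :: complex) \<noteq> 0"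
      using power_neq_1[OF t] by auto
    then show ?thesis
      using True by (simp add: odd_lambert_def power_mult_distrib divide_simps) (simp add: algebra_simps)
  qed (simp add: odd_lambert_def)
  ultimately have "(\<lambda>n. if odd n then a ^ n / of_nat n else 0) sums (L a - L (a * t))"
    by simp
  then have "L a - L (a * t) = (ln (1 + a) - ln (1 - a)) / 2"
    using odd_log_series[OF a] sums_unique2 by blast
  then have eq: "- 2 * L a = ln (1 - a) - ln (1 + a) + - 2 * L (a * t)"
    by (simp add: field_simps)
  have nz: "1 + a \<noteq> 0" "1 - a \<noteq> 0"
    using a by (auto simp: add_eq_0_iff)
  show ?thesis
    unfolding L_def[symmetric] eq exp_add exp_diff using nz by (simp add: exp_Ln)
qed

lemma exp_odd_lambert_iterate:
  assumes t: "norm t < 1" and a: "norm a < 1"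
  shows "exp (- 2 * eval_fps (odd_lambert t) a) * (\<Prod>j<N. 1 + a * t ^ j) =
         (\<Prod>j<N. 1 - a * t ^ j) * exp (- 2 * eval_fps (odd_lambert t) (a * t ^ N))"
proof (induction N)
  case (Suc N)
  define G where "G x = exp (- 2 * eval_fps (odd_lambert t) x)" for x
  have "G (a * t ^ N) * (1 + a * t ^ N) = (1 - a * t ^ N) * G (a * t ^ Suc N)"
    using exp_odd_lambert_shift[OF t norm_mult_power_less_1[OF t a, of N]]
    by (simp add: G_def mult_ac)
  then show ?case
    using Suc.IH unfolding G_def[symmetric] by simp (metis mult.assoc mult.commute)
qed simp

lemma exp_odd_lambert_qpoch:
  assumes t: "norm t < 1" and a: "norm a < 1"
  shows "exp (- 2 * eval_fps (odd_lambert t) a) * qpoch (- a) t = qpoch a t"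
proof -
  define L where "L = eval_fps (odd_lambert t)"
  have lim: "(\<lambda>N. \<Prod>j<Suc N. 1 - b * t ^ j) \<longlonglongrightarrow> qpoch b t" for b
    using convergent_prod_LIMSEQ[OF qpoch_convergent[OF t]]
    by (simp add: qpoch_def lessThan_Suc_atMost)
  have "isCont L 0"
    unfolding L_def by (intro continuous_eval_fps less_le_trans[OF _ odd_lambert_conv_radius[OF t]]) simp
  moreover have "(\<lambda>N. a * t ^ Suc N) \<longlonglongrightarrow> a * 0"
    by (intro tendsto_mult_left LIMSEQ_Suc LIMSEQ_power_zero t)
  ultimately have "(\<lambda>N. L (a * t ^ Suc N)) \<longlonglongrightarrow> L 0"
    by (intro isCont_tendsto_compose[of 0 L]) auto
  also have "L 0 = 0"
    by (simp add: L_def eval_fps_at_0 odd_lambert_def)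
  finally have lim_rhs: "(\<lambda>N. (\<Prod>j<Suc N. 1 - a * t ^ j) * exp (- 2 * L (a * t ^ Suc N)))
      \<longlonglongrightarrow> qpoch a t * exp (- 2 * 0)"
    by (intro tendsto_mult lim tendsto_exp tendsto_const)
  have lim_lhs: "(\<lambda>N. exp (- 2 * L a) * (\<Prod>j<Suc N. 1 - (- a) * t ^ j))
      \<longlonglongrightarrow> exp (- 2 * L a) * qpoch (- a) t"
    by (intro tendsto_mult lim tendsto_const)
  have "exp (- 2 * L a) * (\<Prod>j<Suc N. 1 - (- a) * t ^ j) =
      (\<Prod>j<Suc N. 1 - a * t ^ j) * exp (- 2 * L (a * t ^ Suc N))" for N
    using exp_odd_lambert_iterate[OF t a, of "Suc N"] unfolding L_def by (simp only: mult_minus_left diff_minus_eq_add)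
  then have "exp (- 2 * L a) * qpoch (- a) t = qpoch a t * exp (- 2 * 0)"
    using LIMSEQ_unique[OF lim_lhs] lim_rhs by presburger
  then show ?thesis
    by (simp add: L_def)
qed

lemma F_term_sums:
  assumes t: "norm t < 1" and u: "norm u < 1" and su: "norm (s * u) < 1"
  shows "F_term t s u sums (eval_fps (odd_lambert t) u - eval_fps (odd_lambert t) (s * u))"
proof -
  have "(\<lambda>n. odd_lambert t $ n * u ^ n - odd_lambert t $ n * (s * u) ^ n)
      sums (eval_fps (odd_lambert t) u - eval_fps (odd_lambert t) (s * u))"
    by (intro sums_diff odd_lambert_sums assms)
  moreover have "odd_lambert t $ n * u ^ n - odd_lambert t $ n * (s * u) ^ n = F_term t s u n" for n
    by (simp add: odd_lambert_def F_term_def power_mult_distrib algebra_simps diff_divide_distrib)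
  ultimately show ?thesis by simp
qed

lemma F_eq_qpoch:
  assumes t: "norm t < 1" and u: "norm u < 1" and su: "norm (s * u) < 1"
  shows "F t s u = (qpoch u t * qpoch (- s * u) t) / (qpoch (- u) t * qpoch (s * u) t)"
proof -
  define L where "L = eval_fps (odd_lambert t)"
  have "F t s u = exp (- 2 * L u - - 2 * L (s * u))"
    using sums_unique[OF F_term_sums[OF assms]] by (simp add: F_def L_def algebra_simps)
  also have "\<dots> = exp (- 2 * L u) / exp (- 2 * L (s * u))"
    by (rule exp_diff)
  also have "exp (- 2 * L u) = qpoch u t / qpoch (- u) t"
    using exp_odd_lambert_qpoch[OF t u] qpoch_nonzero[OF t, of "- u"] u
    by (simp add: L_def field_simps)
  also have "exp (- 2 * L (s * u)) = qpoch (s * u) t / qpoch (- s * u) t"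
    using exp_odd_lambert_qpoch[OF t su] qpoch_nonzero[OF t, of "- s * u"] su
    by (simp add: L_def field_simps)
  finally show ?thesis by simp
qed

text \<open>
  On a disc where \<open>u\<close> and \<open>s u\<close> stay inside the unit disc, the exponent of \<open>F\<close> is the sum of its
  power series, and \<open>fps_exp 1\<close> composed with that series is \<open>F_fps\<close> by definition.
\<close>

lemma F_has_fps_expansion:
  assumes t: "norm t < 1"
    and r: "r > 0" "\<And>u. norm u < r \<Longrightarrow> norm u < 1 \<and> norm (s * u) < 1"
  shows "F t s has_fps_expansion F_fps t s"
proof -
  define A where
    "A = Abs_fps (\<lambda>n. if odd n then - 2 * ((1 - s ^ n) / (1 - t ^ n)) / of_nat n else 0)"
  have "(\<lambda>u. - 2 * (\<Sum>n. F_term t s u n)) has_fps_expansion A"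
  proof (rule has_fps_expansionI, rule eventually_nhds_metric[THEN iffD2], intro exI conjI allI impI)
    fix u :: complex
    assume "dist u 0 < r"
    then have "summable (F_term t s u)"
      using F_term_sums[OF t] r(2)[of u] by (auto simp: sums_iff)
    then have "(\<lambda>n. - 2 * F_term t s u n) sums (- 2 * (\<Sum>n. F_term t s u n))"
      by (intro sums_mult summable_sums)
    moreover have "- 2 * F_term t s u n = A $ n * u ^ n" for n
      by (simp add: A_def F_term_def algebra_simps diff_divide_distrib)
    ultimately show "(\<lambda>n. A $ n * u ^ n) sums (- 2 * (\<Sum>n. F_term t s u n))"
      by simp
  qed (use r in auto)
  then have "(exp \<circ> (\<lambda>u. - 2 * (\<Sum>n. F_term t s u n))) has_fps_expansion (fps_exp 1 oo A)"
    by (intro has_fps_expansion_compose has_fps_expansion_exp1) (auto simp: A_def)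
  then show ?thesis
    by (simp add: F_def[abs_def] F_fps_def A_def o_def)
qed

section \<open>Uniqueness principles for formal power series\<close>

text \<open>
  If \<open>Z\<close> vanishes below degree \<open>n = m + 1\<close>, the coefficient of degree \<open>m\<close> in
  \<open>Z' D = E Z\<close> reads \<open>n Z\<^sub>n = 0\<close>.
\<close>

lemma linear_ode_unique_0:
  fixes Z D E :: "'a :: {idom, semiring_char_0} fps"
  assumes ode: "fps_deriv Z * D = E * Z" and D: "D $ 0 = 1" and Z: "Z $ 0 = 0"
  shows "Z = 0"
proof -
  have "Z $ n = 0" for n
  proof (induction n rule: less_induct)
    case (less n)
    show ?case
    proof (cases n)
      case (Suc m)
      have "(fps_deriv Z * D) $ m = (\<Sum>i=0..m. if i = m then fps_deriv Z $ m * D $ 0 else 0)"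
        unfolding fps_mult_nth using less.IH Suc by (intro sum.cong) auto
      also have "\<dots> = of_nat n * Z $ n"
        using D Suc by simp
      finally have "of_nat n * Z $ n = (E * Z) $ m"
        using ode by simp
      also have "\<dots> = 0"
        unfolding fps_mult_nth using less.IH Suc by (intro sum.neutral) auto
      finally have "of_nat (Suc m) * Z $ n = 0"
        using Suc by simp
      then show ?thesis
        unfolding mult_eq_0_iff of_nat_eq_0_iff by simp
    qed (use Z in simp)
  qed
  then show ?thesis by (simp add: fps_eq_iff)
qed

lemma linear_ode_unique:
  fixes Y Z D E :: "'a :: {idom, semiring_char_0} fps"
  assumes "fps_deriv Y * D = E * Y" "fps_deriv Z * D = E * Z" "D $ 0 = 1" "Y $ 0 = Z $ 0"
  shows "Y = Z"
proof -
  have "fps_deriv (Y - Z) * D = E * (Y - Z)"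
    using assms(1,2) by (simp add: algebra_simps)
  then have "Y - Z = 0"
    by (rule linear_ode_unique_0) (use assms in auto)
  then show ?thesis by simp
qed

text \<open>
  The difference \<open>W\<close> of two solutions of \<open>Y(u) = D(u) Y(q u)\<close> satisfies the same equation. If
  it vanishes below degree \<open>n\<close>, then the coefficient of degree \<open>n\<close> gives
  \<open>W\<^sub>n = q^n W\<^sub>n\<close>.
\<close>

lemma q_difference_unique:
  fixes Y Z D :: "'a :: idom fps"
  assumes Y: "Y = D * (Y oo (fps_const q * fps_X))"
    and Z: "Z = D * (Z oo (fps_const q * fps_X))"
    and D: "D $ 0 = 1" and q: "\<And>n. n > 0 \<Longrightarrow> q ^ n \<noteq> 1" and eq0: "Y $ 0 = Z $ 0"
  shows "Y = Z"
proof -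
  define W where "W = Y - Z"
  have W: "W = D * (W oo (fps_const q * fps_X))"
    using Y Z unfolding W_def fps_compose_sub_distrib by (metis right_diff_distrib)
  have "W $ n = 0" for n
  proof (induction n rule: less_induct)
    case (less n)
    show ?case
    proof (cases "n = 0")
      case False
      have "W $ n = (\<Sum>i=0..n. D $ i * (q ^ (n - i) * W $ (n - i)))"
        by (subst W) (simp add: fps_mult_nth)
      also have "\<dots> = (\<Sum>i=0..n. if i = 0 then q ^ n * W $ n else 0)"
        using less.IH D by (intro sum.cong) auto
      also have "\<dots> = q ^ n * W $ n"
        by simp
      finally have "(1 - q ^ n) * W $ n = 0"
        by (simp add: algebra_simps)
      then show ?thesis
        using q[of n] False by auto
    qed (simp add: W_def eq0)
  qed
  then have "W = 0" by (simp add: fps_eq_iff)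
  then show ?thesis by (simp add: W_def)
qed

section \<open>Limits in the \<open>t\<close>-adic topology\<close>

lemma tvar_power_dvd_iff: "tvar ^ k dvd f \<longleftrightarrow> (\<forall>n. \<forall>m<k. f $ n $ m = 0)"
proof -
  have tv: "tvar ^ k = fps_const (fps_X ^ k)"
    by (simp add: tvar_def fps_const_power)
  show ?thesis
  proof
    assume "tvar ^ k dvd f"
    then show "\<forall>n. \<forall>m<k. f $ n $ m = 0"
      by (auto simp: tv dvd_def fps_X_power_mult_nth)
  next
    assume *: "\<forall>n. \<forall>m<k. f $ n $ m = 0"
    have "f = tvar ^ k * Abs_fps (\<lambda>n. Abs_fps (\<lambda>m. f $ n $ (m + k)))"
      using * by (auto simp: tv fps_eq_iff fps_X_power_mult_nth)
    then show "tvar ^ k dvd f" by (rule dvdI)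
  qed
qed

lemma tadic_limit_unique:
  assumes "tadic_limit X L" "tadic_limit X M"
  shows "L = M"
proof -
  have dvd: "tvar ^ k dvd L - M" for k
  proof -
    have "\<forall>\<^sub>F N in sequentially. tvar ^ k dvd X N - L \<and> tvar ^ k dvd X N - M"
      using assms unfolding tadic_limit_def by (auto intro: eventually_conj)
    then obtain N where "tvar ^ k dvd X N - L" "tvar ^ k dvd X N - M"
      unfolding eventually_sequentially by blast
    then have "tvar ^ k dvd (X N - M) - (X N - L)"
      by (metis dvd_diff)
    then show ?thesis by simp
  qed
  have "(L - M) $ n $ m = 0" for n m
    using dvd[of "Suc m"] unfolding tvar_power_dvd_iff by blast
  then show ?thesis by (simp add: fps_eq_iff)
qed

text \<open>
  Completeness: the coefficient of \<open>t^m\<close> in each coefficient of \<open>X N\<close> is constant from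
  \<open>N = m + 1\<close> on.
\<close>

lemma tadic_limit_exists:
  assumes step: "\<And>N. tvar ^ N dvd X (Suc N) - X N"
  shows "\<exists>L. tadic_limit X L"
proof
  define L where "L = Abs_fps (\<lambda>n. Abs_fps (\<lambda>m. X (Suc m) $ n $ m))"
  have const: "X (k + d) $ n $ m = X k $ n $ m" if "m < k" for k d n m
  proof (induction d)
    case (Suc d)
    have "(X (Suc (k + d)) - X (k + d)) $ n $ m = 0"
      using step[of "k + d"] that unfolding tvar_power_dvd_iff by simp
    then show ?case using Suc by simp
  qed simp
  have "tvar ^ k dvd X N - L" if "N \<ge> k" for k N
    unfolding tvar_power_dvd_iff
  proof (intro allI impI)
    fix n m assume "m < k"
    then show "(X N - L) $ n $ m = 0"
      using const[of m "Suc m" "N - Suc m" n] that by (simp add: L_def)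
  qed
  then show "tadic_limit X L"
    unfolding tadic_limit_def eventually_sequentially by blast
qed

lemma formal_qpoch_limit: "tadic_limit (formal_qpoch_partial a) (formal_qpoch a)"
proof -
  have "formal_qpoch_partial a (Suc N) - formal_qpoch_partial a N =
      tvar ^ N * (- a * formal_qpoch_partial a N)" for N
    by (simp add: formal_qpoch_partial_def algebra_simps)
  then have "\<exists>L. tadic_limit (formal_qpoch_partial a) L"
    by (intro tadic_limit_exists) simp
  then have "\<exists>!L. tadic_limit (formal_qpoch_partial a) L"
    using tadic_limit_unique by blast
  then show ?thesis
    unfolding formal_qpoch_def by (rule theI')
qed

lemma formal_qpoch_eqI: "tadic_limit (formal_qpoch_partial a) L \<Longrightarrow> formal_qpoch a = L"
  using tadic_limit_unique formal_qpoch_limit by blast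

section \<open>The \<open>t\<close>-difference equation of the formal Pochhammer symbol\<close>

text \<open>The substitution \<open>u \<mapsto> t u\<close>, a ring endomorphism that fixes \<open>t\<close>.\<close>

abbreviation dilate :: "fring \<Rightarrow> fring" where
  "dilate f \<equiv> f oo (tvar * fps_X)"

lemma dilate_mult: "dilate (f * g) = dilate f * dilate g"
  by (rule fps_compose_mult_distrib) simp

lemma dilate_tvar_power: "dilate (tvar ^ k) = tvar ^ k"
  by (simp add: tvar_def fps_const_power)

lemma formal_qpoch_shift: "formal_qpoch a = (1 - a) * formal_qpoch (a * tvar)"
proof (rule formal_qpoch_eqI)
  have eq: "formal_qpoch_partial a (Suc N) = (1 - a) * formal_qpoch_partial (a * tvar) N" for N
    unfolding formal_qpoch_partial_def by (subst prod.lessThan_Suc_shift) (simp add: mult_ac)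
  show "tadic_limit (formal_qpoch_partial a) ((1 - a) * formal_qpoch (a * tvar))"
    unfolding tadic_limit_def
  proof
    fix k
    have "\<forall>\<^sub>F N in sequentially. tvar ^ k dvd formal_qpoch_partial (a * tvar) N - formal_qpoch (a * tvar)"
      using formal_qpoch_limit unfolding tadic_limit_def by blast
    then have "\<forall>\<^sub>F N in sequentially. tvar ^ k dvd
        formal_qpoch_partial a (Suc N) - (1 - a) * formal_qpoch (a * tvar)"
      by eventually_elim (simp add: eq flip: right_diff_distrib)
    then show "\<forall>\<^sub>F N in sequentially. tvar ^ k dvd
        formal_qpoch_partial a N - (1 - a) * formal_qpoch (a * tvar)"
      by (subst (asm) eventually_sequentially_Suc)
  qed
qed

lemma formal_qpoch_dilate: "formal_qpoch (dilate a) = dilate (formal_qpoch a)"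
proof (rule formal_qpoch_eqI)
  have eq: "formal_qpoch_partial (dilate a) N = dilate (formal_qpoch_partial a N)" for N
    unfolding formal_qpoch_partial_def
    by (subst fps_compose_prod_distrib)
       (simp_all add: fps_compose_sub_distrib dilate_mult dilate_tvar_power)
  have dvd: "tvar ^ k dvd dilate f" if "tvar ^ k dvd f" for k f
    using that by (auto simp: dvd_def dilate_mult dilate_tvar_power)
  show "tadic_limit (formal_qpoch_partial (dilate a)) (dilate (formal_qpoch a))"
    unfolding tadic_limit_def eq fps_compose_sub_distrib[symmetric]
    using formal_qpoch_limit[of a] unfolding tadic_limit_def by (auto elim!: eventually_mono intro: dvd)
qed

lemma formal_qpoch_q_difference:
  "formal_qpoch (fps_const c * uvar) =
    (1 - fps_const c * uvar) * dilate (formal_qpoch (fps_const c * uvar))"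
proof -
  have "dilate (fps_const c * uvar) = fps_const c * uvar * tvar"
    by (simp add: dilate_mult uvar_def mult_ac)
  then show ?thesis
    using formal_qpoch_shift[of "fps_const c * uvar"] formal_qpoch_dilate[of "fps_const c * uvar"]
    by simp
qed

lemma formal_qpoch_nth_0: "formal_qpoch (fps_const c * uvar) $ 0 = 1"
proof -
  have "formal_qpoch_partial (fps_const c * uvar) N $ 0 = 1" for N
    by (induction N) (simp_all add: formal_qpoch_partial_def uvar_def)
  moreover have "\<exists>N. tvar ^ k dvd formal_qpoch_partial (fps_const c * uvar) N - formal_qpoch (fps_const c * uvar)" for k
    using formal_qpoch_limit unfolding tadic_limit_def eventually_sequentially by blast
  ultimately have "(1 - formal_qpoch (fps_const c * uvar) $ 0) $ m = 0" for m
    unfolding tvar_power_dvd_iff by (metis fps_sub_nth lessI)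
  then show ?thesis
    by (simp add: fps_eq_iff)
qed

section \<open>The formal exponential\<close>

lemma formal_exp_deriv: "fps_deriv formal_exp = formal_exp"
proof (rule fps_ext)
  fix n
  have "(of_nat (Suc n) :: rat poly fps) * fps_const [:1 / fact (Suc n):] = fps_const [:1 / fact n:]"
    by (simp add: fps_of_nat[symmetric] of_nat_poly fact_Suc divide_simps del: of_nat_Suc)
  then show "fps_deriv formal_exp $ n = formal_exp $ n"
    by (simp add: formal_exp_def del: of_nat_Suc)
qed

lemma formal_exp_compose_deriv:
  fixes A :: fring
  assumes "A $ 0 = 0"
  shows "fps_deriv (formal_exp oo A) = (formal_exp oo A) * fps_deriv A"
  using fps_compose_deriv[OF assms, of formal_exp] by (simp add: formal_exp_deriv)

lemma formal_exp_nth_0: "formal_exp $ 0 = 1"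
  by (simp add: formal_exp_def pCons_one)

lemma formal_exp_add:
  fixes A B :: fring
  assumes "A $ 0 = 0" "B $ 0 = 0"
  shows "formal_exp oo (A + B) = (formal_exp oo A) * (formal_exp oo B)"
proof (rule linear_ode_unique[where D = 1 and E = "fps_deriv A + fps_deriv B"])
  show "fps_deriv (formal_exp oo (A + B)) * 1 =
      (fps_deriv A + fps_deriv B) * (formal_exp oo (A + B))"
    using assms by (simp add: formal_exp_compose_deriv mult.commute)
  show "fps_deriv ((formal_exp oo A) * (formal_exp oo B)) * 1 =
      (fps_deriv A + fps_deriv B) * ((formal_exp oo A) * (formal_exp oo B))"
    using assms by (simp add: formal_exp_compose_deriv algebra_simps)
qed (simp_all add: formal_exp_nth_0)

text \<open>
  The series \<open>- 2 \<Sum> (c u)^n / n\<close> over odd \<open>n\<close>, that is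
  \<open>log((1 - c u) / (1 + c u))\<close>. The factor \<open>- 2\<close> is part of the definition.
\<close>

definition formal_odd_log :: "rat poly fps \<Rightarrow> fring" where
  "formal_odd_log c = Abs_fps (\<lambda>n. if odd n then fps_const [:- 2 / of_nat n:] * c ^ n else 0)"

lemma formal_odd_log_deriv:
  "fps_deriv (formal_odd_log c) * (1 - fps_const (c ^ 2) * uvar ^ 2) = - 2 * fps_const c"
proof -
  have cst: "of_nat (Suc n) * (fps_const [:- 2 / of_nat (Suc n):] * c ^ Suc n) = - 2 * c ^ Suc n" for n
  proof -
    have "(of_nat (Suc n) :: rat poly fps) * fps_const [:- 2 / of_nat (Suc n):] = fps_const [:- 2:]"
      by (simp add: fps_of_nat[symmetric] of_nat_poly divide_simps del: of_nat_Suc)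
    also have "\<dots> = - 2"
      by (simp add: numeral_fps_const numeral_poly)
    finally show ?thesis by (simp add: mult.assoc[symmetric])
  qed
  have der: "fps_deriv (formal_odd_log c) $ n = (if even n then - 2 * c ^ Suc n else 0)" for n
    using cst[of n] by (simp add: formal_odd_log_def del: of_nat_Suc power_Suc)
  show ?thesis
  proof (rule fps_ext)
    fix n
    have "(fps_deriv (formal_odd_log c) * (1 - fps_const (c ^ 2) * uvar ^ 2)) $ n =
       fps_deriv (formal_odd_log c) $ n -
       (if n < 2 then 0 else c ^ 2 * fps_deriv (formal_odd_log c) $ (n - 2))"
      by (simp add: right_diff_distrib mult.left_commute[of _ "fps_const (c ^ 2)"]
          uvar_def fps_X_power_mult_right_nth del: fps_deriv_nth)
    also have "\<dots> = (- 2 * fps_const c) $ n"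
    proof -
      consider "n = 0" | "n = 1" | m where "n = m + 2"
        by (metis One_nat_def add_2_eq_Suc' not0_implies_Suc)
      then show ?thesis
        by cases (auto simp: der fps_numeral_nth numeral_fps_const power2_eq_square mult_ac simp del: fps_deriv_nth)
    qed
    finally show "(fps_deriv (formal_odd_log c) * (1 - fps_const (c ^ 2) * uvar ^ 2)) $ n =
       (- 2 * fps_const c) $ n" .
  qed
qed

text \<open>
  With \<open>x = c u\<close>, both sides \<open>Y\<close> solve \<open>Y' (1 + x) (1 - x) = - c (1 + x) Y\<close>. The common factor
  \<open>1 + x\<close> is kept so that \<open>formal_odd_log_deriv\<close> applies to the left-hand side.
\<close>

lemma formal_exp_odd_log:
  "(formal_exp oo formal_odd_log c) * (1 + fps_const c * uvar) = 1 - fps_const c * uvar"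
proof -
  define W where "W = formal_exp oo formal_odd_log c"
  define x where "x = fps_const c * uvar"
  have D: "1 - fps_const (c ^ 2) * uvar ^ 2 = (1 + x) * (1 - x)"
    by (simp add: x_def algebra_simps power2_eq_square flip: fps_const_mult)
  have dx: "fps_deriv x = fps_const c"
    by (simp add: x_def uvar_def)
  have dW: "fps_deriv W = W * fps_deriv (formal_odd_log c)"
    unfolding W_def by (rule formal_exp_compose_deriv) (simp add: formal_odd_log_def)
  have L: "fps_deriv (formal_odd_log c) * ((1 + x) * (1 - x)) = - 2 * fps_const c"
    using formal_odd_log_deriv[of c] by (simp add: D)
  have "W * (1 + x) = 1 - x"
  proof (rule linear_ode_unique[where D = "(1 + x) * (1 - x)" and E = "- fps_const c * (1 + x)"])
    have "fps_deriv (W * (1 + x)) * ((1 + x) * (1 - x)) =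
      W * (1 + x) * (fps_deriv (formal_odd_log c) * ((1 + x) * (1 - x))) + W * fps_const c * ((1 + x) * (1 - x))"
      by (simp add: dW dx algebra_simps)
    also have "\<dots> = - fps_const c * (1 + x) * (W * (1 + x))"
      unfolding L by (simp add: algebra_simps del: fps_const_neg)
    finally show "fps_deriv (W * (1 + x)) * ((1 + x) * (1 - x)) =
      - fps_const c * (1 + x) * (W * (1 + x))" .
    show "fps_deriv (1 - x) * ((1 + x) * (1 - x)) = - fps_const c * (1 + x) * (1 - x)"
      by (simp add: dx algebra_simps)
  qed (simp_all add: x_def uvar_def W_def formal_exp_nth_0)
  then show ?thesis by (simp add: W_def x_def)
qed

section \<open>The formal identity\<close>

text \<open>In the topology of power series a sum converges once each coefficient is eventually constant.\<close>

lemma geom_sums: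
  assumes "n \<ge> 1"
  shows "(\<lambda>j. fps_X ^ (j * n) :: rat poly fps) sums Abs_fps (\<lambda>m. if n dvd m then 1 else 0)"
  unfolding sums_def
proof (rule tendsto_fpsI)
  fix m
  show "\<forall>\<^sub>F N in sequentially. (\<Sum>j<N. fps_X ^ (j * n) :: rat poly fps) $ m =
      Abs_fps (\<lambda>m. if n dvd m then 1 else 0) $ m"
    using eventually_gt_at_top[of m]
  proof eventually_elim
    case (elim N)
    have "(\<Sum>j<N. fps_X ^ (j * n) :: rat poly fps) $ m = (\<Sum>j<N. if j * n = m then 1 else 0)"
      unfolding fps_sum_nth by (intro sum.cong) auto
    also have "\<dots> = (if n dvd m then 1 else 0)"
    proof (cases "n dvd m")
      case True
      then obtain i where i: "m = i * n" by (auto simp: dvd_def mult.commute)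
      have "i \<le> m" using assms i by simp
      then have "i < N" using elim by simp
      moreover have "(\<Sum>j<N. if j * n = m then 1 else 0 :: rat poly) = (\<Sum>j<N. if j = i then 1 else 0)"
        using assms i by (intro sum.cong) auto
      ultimately show ?thesis using True by simp
    qed (auto intro!: sum.neutral)
    finally show ?case by simp
  qed
qed

lemma geom_inverse:
  assumes "n \<ge> 1"
  shows "geom n * (1 - fps_X ^ n) = 1"
proof -
  have g: "geom n = Abs_fps (\<lambda>m. if n dvd m then 1 else 0)"
    unfolding geom_def using geom_sums[OF assms] by (simp add: sums_iff)
  show ?thesis
  proof (rule fps_ext)
    fix m
    show "(geom n * (1 - fps_X ^ n)) $ m = 1 $ m"
      using assms dvd_imp_le[of n m]
      by (auto simp: g right_diff_distrib fps_X_power_mult_right_nth dvd_minus_self)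
  qed
qed

text \<open>
  The series \<open>- 2 L(c u)\<close> as an element of \<open>\<rat>[s][[t]][[u]]\<close>. In contrast to \<open>odd_lambert\<close>,
  the factor \<open>- 2\<close> and the scaling of the variable by \<open>c\<close> are part of the definition.
\<close>

definition formal_odd_lambert :: "rat poly fps \<Rightarrow> fring" where
  "formal_odd_lambert c =
    Abs_fps (\<lambda>n. if odd n then fps_const [:- 2 / of_nat n:] * c ^ n * geom n else 0)"

lemma formal_odd_lambert_shift:
  "formal_odd_lambert c = formal_odd_log c + dilate (formal_odd_lambert c)"
proof (rule fps_ext)
  fix n
  show "formal_odd_lambert c $ n = (formal_odd_log c + dilate (formal_odd_lambert c)) $ n"
  proof (cases "odd n")
    case True
    then have "n \<ge> 1" by (cases n) auto
    define b where "b = fps_const [:- 2 / of_nat n:] * c ^ n"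
    have "b * geom n = b * (geom n * (1 - fps_X ^ n)) + fps_X ^ n * (b * geom n)"
      by (simp add: algebra_simps)
    also have "geom n * (1 - fps_X ^ n) = 1"
      by (rule geom_inverse) fact
    finally show ?thesis
      using True by (simp add: formal_odd_lambert_def formal_odd_log_def tvar_def b_def)
  qed (simp add: formal_odd_lambert_def formal_odd_log_def tvar_def)
qed

text \<open>
  Both sides solve \<open>Y(u) = (1 - c u) Y(t u)\<close> with constant term 1. On the left, the factor
  \<open>1 + c u\<close> contributed by the Pochhammer symbol cancels the denominator of
  \<open>exp(formal_odd_log c) = (1 - c u) / (1 + c u)\<close>.
\<close>

lemma formal_exp_odd_lambert_qpoch:
  "(formal_exp oo formal_odd_lambert c) * formal_qpoch (fps_const (- c) * uvar) =
    formal_qpoch (fps_const c * uvar)"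
proof -
  define H where "H = formal_exp oo formal_odd_lambert c"
  define P where "P = formal_qpoch (fps_const (- c) * uvar)"
  define x where "x = fps_const c * uvar"
  have "H = formal_exp oo (formal_odd_log c + dilate (formal_odd_lambert c))"
    unfolding H_def by (subst formal_odd_lambert_shift) simp
  also have "\<dots> = (formal_exp oo formal_odd_log c) * (formal_exp oo dilate (formal_odd_lambert c))"
    by (rule formal_exp_add) (simp_all add: formal_odd_log_def formal_odd_lambert_def)
  also have "formal_exp oo dilate (formal_odd_lambert c) = dilate H"
    unfolding H_def by (rule fps_compose_assoc) (simp_all add: formal_odd_lambert_def)
  finally have H: "H = (formal_exp oo formal_odd_log c) * dilate H" .
  have P: "P = (1 + x) * dilate P"
    using formal_qpoch_q_difference[of "- c"] by (simp add: P_def x_def flip: fps_const_neg)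
  have "H * P = ((formal_exp oo formal_odd_log c) * (1 + x)) * (dilate H * dilate P)"
    by (subst H, subst P) (simp add: mult_ac)
  also have "\<dots> = (1 - x) * dilate (H * P)"
    by (simp add: x_def formal_exp_odd_log dilate_mult)
  finally have HP: "H * P = (1 - x) * dilate (H * P)" .
  have "H * P = formal_qpoch x"
  proof (rule q_difference_unique[where D = "1 - x" and q = fps_X])
    show "H * P = (1 - x) * (H * P oo (fps_const fps_X * fps_X))"
      using HP by (simp add: tvar_def)
    show "formal_qpoch x = (1 - x) * (formal_qpoch x oo (fps_const fps_X * fps_X))"
      using formal_qpoch_q_difference[of c] by (simp add: x_def tvar_def)
    show "(H * P) $ 0 = formal_qpoch x $ 0"
      by (simp add: H_def P_def x_def formal_exp_nth_0 formal_qpoch_nth_0 del: fps_const_neg)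
    show "(fps_X :: rat poly fps) ^ n \<noteq> 1" if "n > 0" for n
      using that by (metis fps_X_power_subdegree subdegree_1 less_irrefl)
  qed (simp add: x_def uvar_def)
  then show ?thesis by (simp add: H_def P_def x_def)
qed

lemma formal_exponent_eq:
  "formal_exponent + formal_odd_lambert (fps_const [:0, 1:]) = formal_odd_lambert 1"
proof (rule fps_ext)
  fix n
  show "(formal_exponent + formal_odd_lambert (fps_const [:0, 1:])) $ n = formal_odd_lambert 1 $ n"
    by (simp add: formal_exponent_def formal_odd_lambert_def fps_const_power algebra_simps
          flip: fps_const_sub)
qed

lemma formal_F_mult_qpoch:
  "formal_F * (formal_qpoch (- uvar) * formal_qpoch (svar * uvar)) =
    formal_qpoch uvar * formal_qpoch (- svar * uvar)"
proof -
  define E where "E c = formal_exp oo formal_odd_lambert c" for c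
  define s where "s = (fps_const [:0, 1:] :: rat poly fps)"
  have F: "formal_F * E s = E 1"
    unfolding formal_F_def E_def s_def formal_exponent_eq[symmetric]
    by (rule formal_exp_add[symmetric]) (simp_all add: formal_exponent_def formal_odd_lambert_def)
  have E1: "E 1 * formal_qpoch (- uvar) = formal_qpoch uvar"
    using formal_exp_odd_lambert_qpoch[of 1] by (simp add: E_def flip: fps_const_neg)
  have Es: "E s * formal_qpoch (- svar * uvar) = formal_qpoch (svar * uvar)"
    using formal_exp_odd_lambert_qpoch[of s] by (simp add: E_def svar_def s_def flip: fps_const_neg)
  have "formal_F * (formal_qpoch (- uvar) * formal_qpoch (svar * uvar)) =
      (formal_F * E s) * formal_qpoch (- uvar) * formal_qpoch (- svar * uvar)"
    unfolding Es[symmetric] by (simp add: mult_ac)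
  also have "\<dots> = formal_qpoch uvar * formal_qpoch (- svar * uvar)"
    by (simp only: F E1)
  finally show ?thesis .
qed

lemma formal_denominator_nth_0:
  "(formal_qpoch (- uvar) * formal_qpoch (svar * uvar)) $ 0 = 1"
  using formal_qpoch_nth_0[of "- 1"] formal_qpoch_nth_0[of "fps_const [:0, 1:]"]
  by (simp add: svar_def flip: fps_const_neg)

lemma eq_mult_right_inverse:
  fixes f g h :: "'a :: comm_ring_1 fps"
  assumes "f * g = h" "g $ 0 = 1"
  shows "f = h * fps_right_inverse g 1"
proof -
  have "g * fps_right_inverse g 1 = 1"
    by (rule fps_right_inverse) (simp add: assms)
  then have "f = f * (g * fps_right_inverse g 1)"
    by simp
  also have "\<dots> = h * fps_right_inverse g 1"
    by (simp only: mult.assoc[symmetric] assms)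
  finally show ?thesis .
qed



theorem proposition3p3:
  shows
    "(\<forall>t s :: complex. norm t < 1 \<longrightarrow>
        (\<exists>r>0. \<forall>u. norm u < r \<longrightarrow>
            summable (F_term t s u) \<and>
            (\<forall>a \<in> {u, - s * u, - u, s * u}. convergent_prod (\<lambda>j. 1 - a * t ^ j)) \<and>
            qpoch (- u) t * qpoch (s * u) t \<noteq> 0 \<and>
            F t s u = (qpoch u t * qpoch (- s * u) t) / (qpoch (- u) t * qpoch (s * u) t)) \<and>
        (\<lambda>u. (qpoch u t * qpoch (- s * u) t) / (qpoch (- u) t * qpoch (s * u) t))
          has_fps_expansion F_fps t s)
     \<and>
     ((\<forall>n\<ge>1. summable (\<lambda>j. fps_X ^ (j * n) :: rat poly fps)) \<and>
      (\<forall>a \<in> {uvar, - svar * uvar, - uvar, svar * uvar}.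
          tadic_limit (formal_qpoch_partial a) (formal_qpoch a)) \<and>
      (formal_qpoch (- uvar) * formal_qpoch (svar * uvar)) $ 0 = 1 \<and>
      formal_F = (formal_qpoch uvar * formal_qpoch (- svar * uvar)) *
        fps_right_inverse (formal_qpoch (- uvar) * formal_qpoch (svar * uvar)) 1)"
proof (intro conjI allI impI)
  fix t s :: complex
  assume t: "norm t < 1"
  define R where "R = (\<lambda>u. (qpoch u t * qpoch (- s * u) t) / (qpoch (- u) t * qpoch (s * u) t))"
  \<comment> \<open>\<open>norm u < r\<close> means \<open>norm u + norm (s * u) < 1\<close>, so that both \<open>u\<close> and \<open>s * u\<close> lie in the unit disc.\<close>
  define r where "r = 1 / (1 + norm s)"
  have r: "r > 0" by (simp add: r_def add_pos_nonneg)
  have small: "norm u < 1 \<and> norm (s * u) < 1" if "norm u < r" for u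
  proof -
    have "norm u * (1 + norm s) < 1"
      using that by (simp add: r_def pos_less_divide_eq add_pos_nonneg)
    then have "norm u + norm s * norm u < 1"
      by (simp add: algebra_simps)
    moreover have "norm s * norm u \<ge> 0" "norm u \<ge> 0"
      by simp_all
    ultimately show ?thesis
      unfolding norm_mult by linarith
  qed
  have eq: "F t s u = R u" if "norm u < r" for u
    unfolding R_def using small[OF that] by (intro F_eq_qpoch t) auto
  show "\<exists>r>0. \<forall>u. norm u < r \<longrightarrow>
      summable (F_term t s u) \<and>
      (\<forall>a \<in> {u, - s * u, - u, s * u}. convergent_prod (\<lambda>j. 1 - a * t ^ j)) \<and>
      qpoch (- u) t * qpoch (s * u) t \<noteq> 0 \<and>
      F t s u = (qpoch u t * qpoch (- s * u) t) / (qpoch (- u) t * qpoch (s * u) t)"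
  proof (intro exI[of _ r] conjI allI impI ballI)
    fix u :: complex
    assume u: "norm u < r"
    show "summable (F_term t s u)"
      using F_term_sums[OF t] small[OF u] by (auto simp: sums_iff)
    show "qpoch (- u) t * qpoch (s * u) t \<noteq> 0"
      using qpoch_nonzero[OF t, of "- u"] qpoch_nonzero[OF t, of "s * u"] small[OF u] by simp
    show "F t s u = (qpoch u t * qpoch (- s * u) t) / (qpoch (- u) t * qpoch (s * u) t)"
      using eq[OF u] by (simp add: R_def)
  qed (use r qpoch_convergent[OF t] in auto)
  have "\<forall>\<^sub>F u in nhds 0. F t s u = R u"
    unfolding eventually_nhds_metric using r eq by (intro exI[of _ r]) auto
  then have "F t s has_fps_expansion F_fps t s \<longleftrightarrow> R has_fps_expansion F_fps t s"
    by (intro has_fps_expansion_cong) auto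
  then show "(\<lambda>u. (qpoch u t * qpoch (- s * u) t) / (qpoch (- u) t * qpoch (s * u) t))
      has_fps_expansion F_fps t s"
    using F_has_fps_expansion[OF t r small] by (simp add: R_def)
next
  show "summable (\<lambda>j. fps_X ^ (j * n) :: rat poly fps)" if "n \<ge> 1" for n
    using geom_sums[OF that] by (simp add: sums_iff)
  show "\<forall>a \<in> {uvar, - svar * uvar, - uvar, svar * uvar}.
      tadic_limit (formal_qpoch_partial a) (formal_qpoch a)"
    using formal_qpoch_limit by blast
  show "(formal_qpoch (- uvar) * formal_qpoch (svar * uvar)) $ 0 = 1"
    by (rule formal_denominator_nth_0)
  show "formal_F = (formal_qpoch uvar * formal_qpoch (- svar * uvar)) *
      fps_right_inverse (formal_qpoch (- uvar) * formal_qpoch (svar * uvar)) 1"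
    by (rule eq_mult_right_inverse[OF formal_F_mult_qpoch formal_denominator_nth_0])
qed

end
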